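(* Let $\mathbb{k}$ be a field and $G$ a finite abelian group with square roots. The map $$\mathrm{WRQF}(G, \mathbb{k}^{\times})/\!\sim \;\to\; \mathrm{WSQF}(G, \mathbb{k}^{\times})/\!\sim, \qquad [(q, \eta, g_0)] \mapsto [(q\eta, g_0^{-2})]$$ is a well-defined bijection.
   Context: $G$ has square roots if for every $g \in G$ there is $h \in G$ with $h^2 = g$. For $q: G \to \mathbb{k}^{\times}$ put $\beta_q(g_1,g_2) = q(g_1g_2)q(g_1)^{-1}q(g_2)^{-1}$. $q$ is a weak quadratic form if $\beta_q$ is a bihomomorphism, and a quadratic form if in addition $q(g)=q(g^{-1})$ for all $g \in G$; the respective groups are $\mathrm{WQF}(G,\mathbb{k}^\times)$ and $\mathrm{QF}(G,\mathbb{k}^\times)$. $\mathrm{WRQF}(G,\mathbb{k}^\times)$ is the set of triples $(q,\eta,g_0)$ with $q\in\mathrm{QF}(G,\mathbb{k}^\times)$, $\eta\in\mathrm{Hom}(G,\mathbb{k}^\times)$, $g_0\in G$ such that $\eta(g)=\beta_q(g,g_0)$ for all $g \in G$; $(q,\eta,g_0)\sim(q',\eta',g_0')$ iff there is $f\in\mathrm{Aut}(G)$ with $q\eta=(q'\eta')\circ f$ and $f(g_0)=g_0'$. $\mathrm{WSQF}(G,\mathbb{k}^\times)$ is the set of pairs $(q,g_0)$ with $q\in\mathrm{WQF}(G,\mathbb{k}^\times)$, $g_0\in G$ and $q(g)=q(g^{-1}g_0)$ for all $g\in G$; $(q,g_0)\sim(q',g_0')$ iff there is $f\in\mathrm{Aut}(G)$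 with $q=q'\circ f$ and $f(g_0)=g_0'$. *)

theory Defs
  imports "HOL-Algebra.Algebra"
begin

text \<open>
  The target group \<open>H\<close> below is instantiated with \<open>units_of K\<close>, the multiplicative group of a
  field \<open>K\<close>. Functions on \<open>G\<close> are taken to be extensional, so that two of them are equal as HOL
  functions exactly when they agree on \<open>carrier G\<close>; automorphisms are the elements of the library's
  \<open>auto G\<close>, which are extensional as well.
\<close>

definition has_square_roots :: "('a, 'm) monoid_scheme \<Rightarrow> bool" where
  "has_square_roots G \<longleftrightarrow>
     (\<forall>g\<in>carrier G. \<exists>h\<in>carrier G. h [^]\<^bsub>G\<^esub> (2::nat) = g)"

definition assoc_form ::
    "('a, 'm) monoid_scheme \<Rightarrow> ('k, 'n) monoid_scheme \<Rightarrow> ('a \<Rightarrow> 'k) \<Rightarrow> 'a \<Rightarrow> 'a \<Rightarrow> 'k" where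
  "assoc_form G H q g\<^sub>1 g\<^sub>2 =
     q (g\<^sub>1 \<otimes>\<^bsub>G\<^esub> g\<^sub>2) \<otimes>\<^bsub>H\<^esub> inv\<^bsub>H\<^esub> (q g\<^sub>1) \<otimes>\<^bsub>H\<^esub> inv\<^bsub>H\<^esub> (q g\<^sub>2)"

definition bihom ::
    "('a, 'm) monoid_scheme \<Rightarrow> ('k, 'n) monoid_scheme \<Rightarrow> ('a \<Rightarrow> 'a \<Rightarrow> 'k) \<Rightarrow> bool" where
  "bihom G H b \<longleftrightarrow>
     (\<forall>x\<in>carrier G. (\<lambda>y. b x y) \<in> hom G H) \<and>
     (\<forall>y\<in>carrier G. (\<lambda>x. b x y) \<in> hom G H)"

definition WQF :: "('a, 'm) monoid_scheme \<Rightarrow> ('k, 'n) monoid_scheme \<Rightarrow> ('a \<Rightarrow> 'k) set" where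
  "WQF G H = {q \<in> carrier G \<rightarrow>\<^sub>E carrier H. bihom G H (assoc_form G H q)}"

definition QF :: "('a, 'm) monoid_scheme \<Rightarrow> ('k, 'n) monoid_scheme \<Rightarrow> ('a \<Rightarrow> 'k) set" where
  "QF G H = {q \<in> WQF G H. \<forall>g\<in>carrier G. q g = q (inv\<^bsub>G\<^esub> g)}"

definition pointwise_mult ::
    "('a, 'm) monoid_scheme \<Rightarrow> ('k, 'n) monoid_scheme \<Rightarrow> ('a \<Rightarrow> 'k) \<Rightarrow> ('a \<Rightarrow> 'k) \<Rightarrow> 'a \<Rightarrow> 'k" where
  "pointwise_mult G H p r = (\<lambda>g\<in>carrier G. p g \<otimes>\<^bsub>H\<^esub> r g)"

definition WRQF ::
    "('a, 'm) monoid_scheme \<Rightarrow> ('k, 'n) monoid_scheme \<Rightarrow> (('a \<Rightarrow> 'k) \<times> ('a \<Rightarrow> 'k) \<times> 'a) set" where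
  "WRQF G H =
     {(q, \<eta>, g\<^sub>0). q \<in> QF G H \<and> \<eta> \<in> hom G H \<inter> extensional (carrier G) \<and> g\<^sub>0 \<in> carrier G \<and>
        (\<forall>g\<in>carrier G. \<eta> g = assoc_form G H q g g\<^sub>0)}"

definition WRQF_rel ::
    "('a, 'm) monoid_scheme \<Rightarrow> ('k, 'n) monoid_scheme \<Rightarrow> (('a \<Rightarrow> 'k) \<times> ('a \<Rightarrow> 'k) \<times> 'a) rel" where
  "WRQF_rel G H =
     {((q, \<eta>, g\<^sub>0), (q', \<eta>', g\<^sub>0')).
        (q, \<eta>, g\<^sub>0) \<in> WRQF G H \<and> (q', \<eta>', g\<^sub>0') \<in> WRQF G H \<and>
        (\<exists>f\<in>auto G. pointwise_mult G H q \<eta> = compose (carrier G) (pointwise_mult G H q' \<eta>') f \<and>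
                     f g\<^sub>0 = g\<^sub>0')}"

definition WSQF ::
    "('a, 'm) monoid_scheme \<Rightarrow> ('k, 'n) monoid_scheme \<Rightarrow> (('a \<Rightarrow> 'k) \<times> 'a) set" where
  "WSQF G H =
     {(q, g\<^sub>0). q \<in> WQF G H \<and> g\<^sub>0 \<in> carrier G \<and>
        (\<forall>g\<in>carrier G. q g = q (inv\<^bsub>G\<^esub> g \<otimes>\<^bsub>G\<^esub> g\<^sub>0))}"

definition WSQF_rel ::
    "('a, 'm) monoid_scheme \<Rightarrow> ('k, 'n) monoid_scheme \<Rightarrow> (('a \<Rightarrow> 'k) \<times> 'a) rel" where
  "WSQF_rel G H =
     {((q, g\<^sub>0), (q', g\<^sub>0')).
        (q, g\<^sub>0) \<in> WSQF G H \<and> (q', g\<^sub>0') \<in> WSQF G H \<and>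
        (\<exists>f\<in>auto G. q = compose (carrier G) q' f \<and> f g\<^sub>0 = g\<^sub>0')}"

definition wrqf_to_wsqf ::
    "('a, 'm) monoid_scheme \<Rightarrow> ('k, 'n) monoid_scheme \<Rightarrow>
     ('a \<Rightarrow> 'k) \<times> ('a \<Rightarrow> 'k) \<times> 'a \<Rightarrow> ('a \<Rightarrow> 'k) \<times> 'a" where
  "wrqf_to_wsqf G H = (\<lambda>(q, \<eta>, g\<^sub>0). (pointwise_mult G H q \<eta>, g\<^sub>0 [^]\<^bsub>G\<^esub> (-2::int)))"

text \<open>
  The map induced on equivalence classes, as the union of the image classes over all
  representatives; well-definedness of \<open>wrqf_to_wsqf\<close> on classes is what makes this union a
  single class.
\<close>

definition wrqf_to_wsqf_class ::
    "('a, 'm) monoid_scheme \<Rightarrow> ('k, 'n) monoid_scheme \<Rightarrow>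
     (('a \<Rightarrow> 'k) \<times> ('a \<Rightarrow> 'k) \<times> 'a) set \<Rightarrow> (('a \<Rightarrow> 'k) \<times> 'a) set" where
  "wrqf_to_wsqf_class G H C = (\<Union>t\<in>C. WSQF_rel G H `` {wrqf_to_wsqf G H t})"

end

theory Submission
  imports Defs
begin

text \<open>
  Let \<open>b\<close> be the bihomomorphism of a weak quadratic form \<open>p\<close>; multiplying \<open>p\<close> by a homomorphism
  does not change \<open>b\<close>. If \<open>p g = q g \<cdot> b(g, g\<^sub>0)\<close>, then \<open>p g \<cdot> q g\<^sub>0 = q (g g\<^sub>0)\<close> and
  \<open>q g \<cdot> p (g\<^sub>0\<inverse>) = p (g g\<^sub>0\<inverse>)\<close>, so symmetry of \<open>q\<close> under \<open>g \<mapsto> g\<inverse>\<close> translates into symmetry of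
  \<open>p\<close> under \<open>g \<mapsto> g\<inverse> g\<^sub>0\<^sup>-\<^sup>2\<close> and back. As squaring is bijective on \<open>G\<close>, the map on representatives is
  onto and the relation on triples is the preimage of the relation on pairs.
\<close>

section \<open>Bijections between quotients\<close>

text \<open>\<open>R\<close> identifies exactly those elements of \<open>A\<close> that become equal
  under the composite of \<open>F\<close> with the projection \<open>B\<close> to
  \<open>B // S\<close>. Hence the induced map is injective, and it is onto because \<open>F\<close>
  is.\<close>

lemma quotient_bij_betw_pullback:
  assumes S: "equiv B S"
    and F: "F ` A = B"
    and R: "\<And>s t. (s, t) \<in> R \<longleftrightarrow> s \<in> A \<and> t \<in> A \<and> (F s, F t) \<in> S"
  shows "equiv A R"
    and "(\<lambda>t. S `` {F t}) respects R"
    and "t \<in> A \<Longrightarrow> (\<Union>s\<in>R `` {t}. S `` {F s}) = S `` {F t}"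
    and "bij_betw (\<lambda>C. \<Union>t\<in>C. S `` {F t}) (A // R) (B // S)"
proof -
  have "refl_on B S" and symS: "sym S" and transS: "trans S"
    using S by (auto elim: equivE)
  then have reflS: "(F t, F t) \<in> S" if "t \<in> A" for t
    using F that by (auto dest: refl_onD)
  show eqR: "equiv A R"
  proof (rule equivI)
    show "R \<subseteq> A \<times> A" using R by auto
    show "refl_on A R"
      using R reflS by (intro refl_onI) auto
    show "sym R"
      using R symD[OF symS] by (intro symI) blast
    show "trans R"
      using R transD[OF transS] by (intro transI) blast
  qed
  show resp: "(\<lambda>t. S `` {F t}) respects R"
    by (rule congruentI) (use R equiv_class_eq[OF S] in blast)
  show cls: "(\<Union>s\<in>R `` {t}. S `` {F s}) = S `` {F t}" if "t \<in> A" for t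
    by (rule UN_equiv_class[OF eqR resp that])
  show "bij_betw (\<lambda>C. \<Union>t\<in>C. S `` {F t}) (A // R) (B // S)"
  proof (intro bij_betwI' iffI)
    fix C D
    assume CD: "C \<in> A // R" "D \<in> A // R"
    assume eq: "(\<Union>t\<in>C. S `` {F t}) = (\<Union>t\<in>D. S `` {F t})"
    from CD obtain x y where x: "x \<in> A" "C = R `` {x}" and y: "y \<in> A" "D = R `` {y}"
      by (auto elim!: quotientE)
    with eq cls have "S `` {F x} = S `` {F y}" by simp
    with x y F have "(F x, F y) \<in> S" by (intro eq_equiv_class[OF _ S]) auto
    with x y R have "(x, y) \<in> R" by simp
    with x y show "C = D" by (simp add: equiv_class_eq[OF eqR])
  next
    fix C assume "C \<in> A // R"
    then obtain x where x: "x \<in> A" "C = R `` {x}" by (auto elim!: quotientE)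
    with cls F show "(\<Union>t\<in>C. S `` {F t}) \<in> B // S" by (auto intro: quotientI)
  next
    fix D assume "D \<in> B // S"
    then obtain y where "y \<in> B" "D = S `` {y}" by (auto elim!: quotientE)
    then obtain x where "x \<in> A" "D = S `` {F x}" using F by auto
    then show "\<exists>C\<in>A // R. D = (\<Union>t\<in>C. S `` {F t})"
      using cls by (intro bexI[of _ "R `` {x}"]) (auto intro: quotientI)
  qed auto
qed

text \<open>Oriented so that simplification with the symmetry condition terminates.\<close>

lemma QF_iff: "q \<in> QF G H \<longleftrightarrow> q \<in> WQF G H \<and> (\<forall>g\<in>carrier G. q (inv\<^bsub>G\<^esub> g) = q g)"
  by (simp only: QF_def mem_Collect_eq) metis

lemma WSQF_iff:
  "(q, a) \<in> WSQF G H \<longleftrightarrow> q \<in> WQF G H \<and> a \<in> carrier G \<and>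
     (\<forall>g\<in>carrier G. q (inv\<^bsub>G\<^esub> g \<otimes>\<^bsub>G\<^esub> a) = q g)"
  by (simp only: WSQF_def mem_Collect_eq prod.case) metis

section \<open>Homomorphisms, powers and square roots\<close>

text \<open>Links the exponent \<open>-2::int\<close> of the map with the exponent
  \<open>2::nat\<close> of \<open>has_square_roots\<close>.\<close>

lemma (in group) int_pow_neg_two:
  "x \<in> carrier G \<Longrightarrow> x [^] (-2::int) = inv (x [^] (2::nat))"
  using int_pow_neg_int[of x 2] by simp

text \<open>Serves functions cut off outside the carrier, such as \<open>pointwise_mult\<close>,
  whose associated forms are controlled only for arguments in \<open>carrier G\<close>.\<close>

lemma hom_cong_on_carrier:
  assumes "group G" "f \<in> hom G H" "\<And>x. x \<in> carrier G \<Longrightarrow> h x = f x"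
  shows "h \<in> hom G H"
  using assms by (auto simp: hom_def Pi_iff monoid.m_closed[OF group.is_monoid])

lemma bihom_cong_on_carrier:
  assumes "group G" "bihom G H b"
    "\<And>x y. x \<in> carrier G \<Longrightarrow> y \<in> carrier G \<Longrightarrow> c x y = b x y"
  shows "bihom G H c"
  using assms unfolding bihom_def by (auto intro: hom_cong_on_carrier)

text \<open>Squaring maps the carrier onto itself, and a surjective self-map of a finite set is
  injective.\<close>

lemma has_square_roots_inj_on:
  assumes G: "group G" "finite (carrier G)" "has_square_roots G"
  shows "inj_on (\<lambda>x. x [^]\<^bsub>G\<^esub> (2::nat)) (carrier G)"
proof -
  interpret group G by fact
  have "carrier G \<subseteq> (\<lambda>x. x [^]\<^bsub>G\<^esub> (2::nat)) ` carrier G"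
    using G unfolding has_square_roots_def by force
  then show ?thesis using G by (intro finite_surj_inj) auto
qed

section \<open>Forms and their bihomomorphisms\<close>

locale two_comm_groups = G: comm_group G + H: comm_group H for G (structure) and H (structure)
begin

text \<open>Clears the inverses from \<open>assoc_form\<close>, so that identities between forms
  become identities between products, which \<open>H.m_ac\<close> settles.\<close>

lemma assoc_form_eq_iff:
  assumes "q \<in> carrier G \<rightarrow> carrier H" "x \<in> carrier G" "y \<in> carrier G" "c \<in> carrier H"
  shows "assoc_form G H q x y = c \<longleftrightarrow> q (x \<otimes>\<^bsub>G\<^esub> y) = c \<otimes>\<^bsub>H\<^esub> q x \<otimes>\<^bsub>H\<^esub> q y"
proof -
  have cl: "q x \<in> carrier H" "q y \<in> carrier H" "q (x \<otimes>\<^bsub>G\<^esub> y) \<in> carrier H"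
    using assms by auto
  have "assoc_form G H q x y = c \<longleftrightarrow> q (x \<otimes>\<^bsub>G\<^esub> y) \<otimes>\<^bsub>H\<^esub> inv\<^bsub>H\<^esub> (q x) = c \<otimes>\<^bsub>H\<^esub> q y"
    unfolding assoc_form_def using cl assms(4)
    by (metis H.inv_solve_right H.m_closed H.inv_closed)
  also have "\<dots> \<longleftrightarrow> q (x \<otimes>\<^bsub>G\<^esub> y) = c \<otimes>\<^bsub>H\<^esub> q y \<otimes>\<^bsub>H\<^esub> q x"
    using cl assms(4) by (metis H.inv_solve_right H.m_closed)
  finally show ?thesis using cl assms(4) by (simp add: H.m_ac)
qed

lemma assoc_form_closed:
  assumes "q \<in> carrier G \<rightarrow> carrier H" "x \<in> carrier G" "y \<in> carrier G"
  shows "assoc_form G H q x y \<in> carrier H"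
  using assms unfolding assoc_form_def by (auto simp: Pi_iff)

lemma mult_expand:
  assumes "q \<in> carrier G \<rightarrow> carrier H" "x \<in> carrier G" "y \<in> carrier G"
  shows "q (x \<otimes>\<^bsub>G\<^esub> y) = assoc_form G H q x y \<otimes>\<^bsub>H\<^esub> q x \<otimes>\<^bsub>H\<^esub> q y"
  using assoc_form_eq_iff[OF assms assoc_form_closed[OF assms]] by simp

text \<open>The factor contributed by \<eta> is \<eta>(xy) divided by \<eta>(x)\<eta>(y), which is
  1.\<close>

lemma assoc_form_pointwise_mult_hom:
  assumes q: "q \<in> carrier G \<rightarrow> carrier H" and \<eta>: "\<eta> \<in> hom G H"
    and x: "x \<in> carrier G" and y: "y \<in> carrier G"
  shows "assoc_form G H (pointwise_mult G H q \<eta>) x y = assoc_form G H q x y"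
proof -
  have cl: "q x \<in> carrier H" "q y \<in> carrier H" "\<eta> x \<in> carrier H" "\<eta> y \<in> carrier H"
    "assoc_form G H q x y \<in> carrier H"
    using assms assoc_form_closed by (auto dest: hom_in_carrier)
  have "pointwise_mult G H q \<eta> \<in> carrier G \<rightarrow> carrier H"
    using q \<eta> by (auto simp: pointwise_mult_def hom_def)
  then show ?thesis
    using cl x y mult_expand[OF q x y] hom_mult[OF \<eta> x y]
    by (simp add: assoc_form_eq_iff pointwise_mult_def H.m_ac)
qed

lemma WQF_pointwise_mult_hom:
  assumes "q \<in> WQF G H" "\<eta> \<in> hom G H"
  shows "pointwise_mult G H q \<eta> \<in> WQF G H"
proof -
  have q: "q \<in> carrier G \<rightarrow> carrier H" and b: "bihom G H (assoc_form G H q)"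
    using assms(1) by (auto simp: WQF_def PiE_def)
  have "bihom G H (assoc_form G H (pointwise_mult G H q \<eta>))"
    by (rule bihom_cong_on_carrier[OF G.is_group b assoc_form_pointwise_mult_hom[OF q assms(2)]])
  then show ?thesis
    using q assms(2) by (auto simp: WQF_def pointwise_mult_def hom_def)
qed

lemma assoc_form_inv_cancel:
  assumes "q \<in> WQF G H" "x \<in> carrier G" "y \<in> carrier G"
  shows "assoc_form G H q x (inv\<^bsub>G\<^esub> y) \<otimes>\<^bsub>H\<^esub> assoc_form G H q x y = \<one>\<^bsub>H\<^esub>"
proof -
  have h: "(\<lambda>y. assoc_form G H q x y) \<in> hom G H"
    using assms by (auto simp: WQF_def bihom_def)
  show ?thesis
    using hom_mult[OF h, of "inv\<^bsub>G\<^esub> y" y] hom_one[OF h] assms by simp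
qed

section \<open>The map on representatives\<close>

lemma wrqf_to_wsqf_in_WSQF:
  assumes "t \<in> WRQF G H"
  shows "wrqf_to_wsqf G H t \<in> WSQF G H"
proof -
  obtain q \<eta> a where t: "t = (q, \<eta>, a)" by (cases t) auto
  have qW: "q \<in> WQF G H" and sym: "\<And>g. g \<in> carrier G \<Longrightarrow> q (inv\<^bsub>G\<^esub> g) = q g"
    and \<eta>: "\<eta> \<in> hom G H" and a: "a \<in> carrier G"
    and \<eta>_eq: "\<And>g. g \<in> carrier G \<Longrightarrow> \<eta> g = assoc_form G H q g a"
    using assms by (auto simp: t WRQF_def QF_iff)
  have q: "q \<in> carrier G \<rightarrow> carrier H" using qW by (auto simp: WQF_def)
  define p where "p = pointwise_mult G H q \<eta>"
  define c where "c = a [^]\<^bsub>G\<^esub> (-2::int)"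
  have c: "c = inv\<^bsub>G\<^esub> a \<otimes>\<^bsub>G\<^esub> inv\<^bsub>G\<^esub> a"
    using a by (simp add: c_def G.int_pow_neg_two numeral_2_eq_2 G.inv_mult)
  have cG: "c \<in> carrier G" using a by (simp add: c)
  have pW: "p \<in> WQF G H" unfolding p_def by (rule WQF_pointwise_mult_hom[OF qW \<eta>])
  have p: "p g \<in> carrier H" if "g \<in> carrier G" for g using pW that by (auto simp: WQF_def)
  \<comment> \<open>Since \<eta> is the form paired with \<open>a\<close>, expanding
    \<open>q\<close> at the product of \<open>g\<close> and \<open>a\<close> yields
    \<open>p g\<close> times \<open>q a\<close>: up to the constant \<open>q a\<close>,
    \<open>p\<close> is a translate of \<open>q\<close>.\<close>
  have shift: "p g \<otimes>\<^bsub>H\<^esub> q a = q (g \<otimes>\<^bsub>G\<^esub> a)" if g: "g \<in> carrier G" for g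
    using mult_expand[OF q g a] assoc_form_closed[OF q g a] funcset_mem[OF q g] g
    by (simp add: p_def pointwise_mult_def \<eta>_eq H.m_comm)
  have "p (inv\<^bsub>G\<^esub> g \<otimes>\<^bsub>G\<^esub> c) = p g" if g: "g \<in> carrier G" for g
  proof -
    have "p (inv\<^bsub>G\<^esub> g \<otimes>\<^bsub>G\<^esub> c) \<otimes>\<^bsub>H\<^esub> q a = q (inv\<^bsub>G\<^esub> g \<otimes>\<^bsub>G\<^esub> c \<otimes>\<^bsub>G\<^esub> a)"
      using g cG by (intro shift) auto
    \<comment> \<open>As \<open>c\<close> is the inverse square of \<open>a\<close>, translating by
      \<open>a\<close> turns the reflection of \<open>p\<close> into plain inversion, under which
      \<open>q\<close> is invariant.\<close>
    also have "inv\<^bsub>G\<^esub> g \<otimes>\<^bsub>G\<^esub> c \<otimes>\<^bsub>G\<^esub> a = inv\<^bsub>G\<^esub> (g \<otimes>\<^bsub>G\<^esub> a)"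
      using g a by (simp add: c G.m_assoc G.inv_mult)
    also have "q \<dots> = p g \<otimes>\<^bsub>H\<^esub> q a"
      using g a by (simp add: sym shift)
    finally show ?thesis
      using g cG p funcset_mem[OF q a] by simp
  qed
  then show ?thesis
    using pW cG by (simp add: t wrqf_to_wsqf_def WSQF_iff flip: p_def c_def)
qed

lemma WSQF_preimage:
  assumes roots: "has_square_roots G" and s: "s \<in> WSQF G H"
  shows "\<exists>t\<in>WRQF G H. wrqf_to_wsqf G H t = s"
proof -
  obtain p c where s_eq: "s = (p, c)" by (cases s)
  have pW: "p \<in> WQF G H" and cG: "c \<in> carrier G"
    and sym: "\<And>g. g \<in> carrier G \<Longrightarrow> p (inv\<^bsub>G\<^esub> g \<otimes>\<^bsub>G\<^esub> c) = p g"
    using s by (auto simp: s_eq WSQF_iff)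
  have p: "p \<in> carrier G \<rightarrow> carrier H" and bi: "bihom G H (assoc_form G H p)"
    and ext: "p \<in> extensional (carrier G)"
    using pW by (auto simp: WQF_def PiE_def)
  \<comment> \<open>The root is taken of the inverse of \<open>c\<close>, because the map sends
    \<open>a\<close> to its power -2.\<close>
  obtain a where a: "a \<in> carrier G" and a2: "a [^]\<^bsub>G\<^esub> (2::nat) = inv\<^bsub>G\<^esub> c"
    using roots cG unfolding has_square_roots_def by (meson G.inv_closed)
  have c_pow: "a [^]\<^bsub>G\<^esub> (-2::int) = c"
    using a a2 cG by (simp add: G.int_pow_neg_two)
  have c: "c = inv\<^bsub>G\<^esub> a \<otimes>\<^bsub>G\<^esub> inv\<^bsub>G\<^esub> a"
    unfolding c_pow[symmetric] using a by (simp add: G.int_pow_neg_two numeral_2_eq_2 G.inv_mult)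
  define \<eta> where "\<eta> = (\<lambda>g\<in>carrier G. assoc_form G H p g a)"
  \<comment> \<open>Twisting by the form paired with the inverse of \<open>a\<close> cancels \<eta>,
    so that multiplying by \<eta> gives back \<open>p\<close>.\<close>
  define q where "q = pointwise_mult G H p (\<lambda>g. assoc_form G H p g (inv\<^bsub>G\<^esub> a))"
  have hom_b: "(\<lambda>g. assoc_form G H p g y) \<in> hom G H" if "y \<in> carrier G" for y
    using bi that by (auto simp: bihom_def)
  have \<eta>: "\<eta> \<in> hom G H"
    by (rule hom_cong_on_carrier[OF G.is_group hom_b[OF a]]) (simp add: \<eta>_def)
  have qW: "q \<in> WQF G H"
    unfolding q_def by (intro WQF_pointwise_mult_hom pW hom_b G.inv_closed a)
  have qcl: "q g \<in> carrier H" if "g \<in> carrier G" for g using qW that by (auto simp: WQF_def)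
  have pcl: "p g \<in> carrier H" if "g \<in> carrier G" for g using p that by auto
  have shift: "q g \<otimes>\<^bsub>H\<^esub> p (inv\<^bsub>G\<^esub> a) = p (g \<otimes>\<^bsub>G\<^esub> inv\<^bsub>G\<^esub> a)" if g: "g \<in> carrier G" for g
    using mult_expand[OF p g, of "inv\<^bsub>G\<^esub> a"] assoc_form_closed[OF p g, of "inv\<^bsub>G\<^esub> a"] pcl g a
    by (simp add: q_def pointwise_mult_def H.m_comm)
  have q_sym: "q (inv\<^bsub>G\<^esub> g) = q g" if g: "g \<in> carrier G" for g
  proof -
    \<comment> \<open>By \<open>shift\<close>, the values of \<open>q\<close> at \<open>g\<close>
      and at its inverse are, up to one common factor, values of \<open>p\<close> at two points;
      these are exchanged by the reflection belonging to \<open>c\<close>.\<close>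
    have "inv\<^bsub>G\<^esub> (inv\<^bsub>G\<^esub> g \<otimes>\<^bsub>G\<^esub> inv\<^bsub>G\<^esub> a) \<otimes>\<^bsub>G\<^esub> c = g \<otimes>\<^bsub>G\<^esub> (a \<otimes>\<^bsub>G\<^esub> (inv\<^bsub>G\<^esub> a \<otimes>\<^bsub>G\<^esub> inv\<^bsub>G\<^esub> a))"
      using g a by (simp add: c G.inv_mult G.m_assoc)
    also have "\<dots> = g \<otimes>\<^bsub>G\<^esub> inv\<^bsub>G\<^esub> a"
      using g a by (simp flip: G.m_assoc)
    finally have "p (g \<otimes>\<^bsub>G\<^esub> inv\<^bsub>G\<^esub> a) = p (inv\<^bsub>G\<^esub> g \<otimes>\<^bsub>G\<^esub> inv\<^bsub>G\<^esub> a)"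
      using sym[of "inv\<^bsub>G\<^esub> g \<otimes>\<^bsub>G\<^esub> inv\<^bsub>G\<^esub> a"] g a by simp
    then have "q g \<otimes>\<^bsub>H\<^esub> p (inv\<^bsub>G\<^esub> a) = q (inv\<^bsub>G\<^esub> g) \<otimes>\<^bsub>H\<^esub> p (inv\<^bsub>G\<^esub> a)"
      using g by (simp add: shift)
    then show ?thesis using g a qcl pcl by simp
  qed
  \<comment> \<open>\<eta> was defined from the form of \<open>p\<close>, but \<open>WRQF\<close>
    asks for that of \<open>q\<close>; the two agree because \<open>q\<close> differs from
    \<open>p\<close> by a homomorphism.\<close>
  have "\<eta> g = assoc_form G H q g a" if "g \<in> carrier G" for g
    using that a assoc_form_pointwise_mult_hom[OF p hom_b that a, of "inv\<^bsub>G\<^esub> a"]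
    by (simp add: \<eta>_def q_def)
  then have "(q, \<eta>, a) \<in> WRQF G H"
    using qW q_sym \<eta> a by (auto simp: WRQF_def QF_iff \<eta>_def)
  moreover have "pointwise_mult G H q \<eta> = p"
  proof (rule extensionalityI[OF _ ext])
    fix g assume g: "g \<in> carrier G"
    show "pointwise_mult G H q \<eta> g = p g"
      using g a assoc_form_inv_cancel[OF pW g a] pcl[OF g]
        assoc_form_closed[OF p g a] assoc_form_closed[OF p g G.inv_closed[OF a]]
      by (simp add: q_def \<eta>_def pointwise_mult_def H.m_assoc)
  qed (simp add: pointwise_mult_def)
  ultimately show ?thesis
    by (intro bexI[of _ "(q, \<eta>, a)"]) (simp_all add: wrqf_to_wsqf_def c_pow s_eq)
qed

section \<open>The two equivalence relations\<close>

text \<open>The witnesses are the identity, the inverse and the composite automorphism. The relation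
  on triples inherits its equivalence property by pullback.\<close>

lemma equiv_WSQF_rel: "equiv (WSQF G H) (WSQF_rel G H)"
proof (rule equivI)
  show "WSQF_rel G H \<subseteq> WSQF G H \<times> WSQF G H"
    by (auto simp: WSQF_rel_def)
  show "refl_on (WSQF G H) (WSQF_rel G H)"
  proof (rule refl_onI)
    fix s assume "s \<in> WSQF G H"
    then obtain q a where s: "s = (q, a)" "(q, a) \<in> WSQF G H" by (cases s) auto
    then have "q = compose (carrier G) q (\<lambda>x\<in>carrier G. x)" "(\<lambda>x\<in>carrier G. x) a = a"
      by (auto simp: WSQF_iff WQF_def PiE_def)
    then show "(s, s) \<in> WSQF_rel G H"
      using s(2) G.id_in_auto unfolding s(1) WSQF_rel_def by blast
  qed
  show "sym (WSQF_rel G H)"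
  proof (rule symI)
    fix s t assume st: "(s, t) \<in> WSQF_rel G H"
    obtain q a q' a' where s: "s = (q, a)" and t: "t = (q', a')" by (metis surj_pair)
    from st obtain f where W: "(q, a) \<in> WSQF G H" "(q', a') \<in> WSQF G H" and f: "f \<in> auto G"
      and q: "q = compose (carrier G) q' f" and fa: "f a = a'"
      by (auto simp: WSQF_rel_def s t)
    have aG: "a \<in> carrier G" and ext: "q' \<in> extensional (carrier G)"
      using W by (auto simp: WSQF_iff WQF_def PiE_def)
    \<comment> \<open>Elements of \<open>auto G\<close> are extensional, hence the restriction of
      the inverse.\<close>
    define h where "h = restrict (inv_into (carrier G) f) (carrier G)"
    have bij: "bij_betw f (carrier G) (carrier G)" and hom: "f \<in> hom G G"
      using f by (auto simp: auto_def Bij_def)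
    have h: "h \<in> auto G"
      using f hom unfolding h_def auto_def
      by (auto intro!: restrict_inv_into_Bij group.restrict_inv_into_hom
          simp: G.is_group simp del: restrict_apply)
    have "q' = compose (carrier G) q h"
      by (rule extensionalityI[OF ext])
        (use bij in \<open>auto simp: q h_def compose_def bij_betw_inv_into_right
           bij_betw_apply[OF bij_betw_inv_into]\<close>)
    moreover have "h a' = a"
      using bij aG fa by (auto simp: h_def bij_betw_inv_into_left bij_betw_apply)
    ultimately show "(t, s) \<in> WSQF_rel G H"
      using W h by (auto simp: WSQF_rel_def s t)
  qed
  show "trans (WSQF_rel G H)"
  proof (rule transI)
    fix s t u assume st: "(s, t) \<in> WSQF_rel G H" and tu: "(t, u) \<in> WSQF_rel G H"
    obtain q a q' a' q'' a'' where s: "s = (q, a)" and t: "t = (q', a')" and u: "u = (q'', a'')"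
      by (metis surj_pair)
    from st obtain f where W: "(q, a) \<in> WSQF G H" and f: "f \<in> auto G"
      and q: "q = compose (carrier G) q' f" and fa: "f a = a'"
      by (auto simp: WSQF_rel_def s t)
    from tu obtain h where W'': "(q'', a'') \<in> WSQF G H" and h: "h \<in> auto G"
      and q': "q' = compose (carrier G) q'' h" and ha: "h a' = a''"
      by (auto simp: WSQF_rel_def t u)
    have fG: "f \<in> carrier G \<rightarrow> carrier G" and hG: "h \<in> carrier G \<rightarrow> carrier G"
      using f h by (auto simp: auto_def hom_def)
    have aG: "a \<in> carrier G" using W by (auto simp: WSQF_iff)
    have "compose (carrier G) h f \<in> auto G"
      using f h fG hG by (auto simp: auto_def compose_Bij intro: G.hom_compose)
    moreover have "q = compose (carrier G) q'' (compose (carrier G) h f)"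
      unfolding q q' by (rule compose_assoc[OF fG, symmetric])
    moreover have "compose (carrier G) h f a = a''"
      using aG fa ha by (simp add: compose_def)
    ultimately show "(s, u) \<in> WSQF_rel G H"
      using W W'' by (auto simp: WSQF_rel_def s u)
  qed
qed

text \<open>Both relations impose the same condition on the product forms and differ only at the
  points. An automorphism commutes with the power -2, and that power is injective on
  \<open>G\<close>, so the conditions on the points agree as well.\<close>

lemma WRQF_rel_iff_WSQF_rel:
  assumes fin: "finite (carrier G)" and roots: "has_square_roots G"
  shows "(s, t) \<in> WRQF_rel G H \<longleftrightarrow>
    s \<in> WRQF G H \<and> t \<in> WRQF G H \<and> (wrqf_to_wsqf G H s, wrqf_to_wsqf G H t) \<in> WSQF_rel G H"
proof -
  obtain q \<eta> a q' \<eta>' a' where s: "s = (q, \<eta>, a)" and t: "t = (q', \<eta>', a')"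
    by (metis surj_pair)
  have "f (a [^]\<^bsub>G\<^esub> (-2::int)) = a' [^]\<^bsub>G\<^esub> (-2::int) \<longleftrightarrow> f a = a'"
    if "f \<in> auto G" "a \<in> carrier G" "a' \<in> carrier G" for f
  proof -
    have f: "f \<in> hom G G" using that by (auto simp: auto_def)
    have fa: "f a \<in> carrier G" using f that by (auto simp: hom_def)
    have "f (a [^]\<^bsub>G\<^esub> (-2::int)) = f a [^]\<^bsub>G\<^esub> (-2::int)"
      by (rule hom_int_pow[OF f that(2) G.is_group G.is_group])
    also have "\<dots> = a' [^]\<^bsub>G\<^esub> (-2::int) \<longleftrightarrow> f a [^]\<^bsub>G\<^esub> (2::nat) = a' [^]\<^bsub>G\<^esub> (2::nat)"
      using fa that by (simp add: G.int_pow_neg_two inj_on_eq_iff[OF G.inv_inj])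
    also have "\<dots> \<longleftrightarrow> f a = a'"
      using inj_onD[OF has_square_roots_inj_on[OF G.is_group fin roots], of "f a" a'] fa that
      by auto
    finally show ?thesis .
  qed
  moreover have "a \<in> carrier G" if "s \<in> WRQF G H" using that by (auto simp: s WRQF_def)
  moreover have "a' \<in> carrier G" if "t \<in> WRQF G H" using that by (auto simp: t WRQF_def)
  ultimately show ?thesis
    using wrqf_to_wsqf_in_WSQF[of s] wrqf_to_wsqf_in_WSQF[of t]
    by (auto simp: WRQF_rel_def WSQF_rel_def wrqf_to_wsqf_def s t)
qed

end

theorem proposition4p2p1:
  fixes G :: "('a, 'm) monoid_scheme" and K :: "('k, 'n) ring_scheme"
  assumes "field K"
    and "comm_group G"
    and "finite (carrier G)"
    and "has_square_roots G"
  shows "equiv (WRQF G (units_of K)) (WRQF_rel G (units_of K)) \<and>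
    equiv (WSQF G (units_of K)) (WSQF_rel G (units_of K)) \<and>
    wrqf_to_wsqf G (units_of K) \<in> WRQF G (units_of K) \<rightarrow> WSQF G (units_of K) \<and>
    (\<lambda>t. WSQF_rel G (units_of K) `` {wrqf_to_wsqf G (units_of K) t})
      respects WRQF_rel G (units_of K) \<and>
    (\<forall>t\<in>WRQF G (units_of K).
      wrqf_to_wsqf_class G (units_of K) (WRQF_rel G (units_of K) `` {t}) =
      WSQF_rel G (units_of K) `` {wrqf_to_wsqf G (units_of K) t}) \<and>
    bij_betw (wrqf_to_wsqf_class G (units_of K))
      (WRQF G (units_of K) // WRQF_rel G (units_of K))
      (WSQF G (units_of K) // WSQF_rel G (units_of K))"
proof -
  interpret K: field K by fact
  interpret G: comm_group G by fact
  interpret two_comm_groups G "units_of K"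
    by (intro two_comm_groups.intro assms K.units_comm_group)
  have map: "wrqf_to_wsqf G (units_of K) ` WRQF G (units_of K) = WSQF G (units_of K)"
    using wrqf_to_wsqf_in_WSQF WSQF_preimage[OF assms(4)] by (auto simp: image_iff) metis
  \<comment> \<open>With \<open>F\<close> the map on representatives, this yields the equivalence on
    triples, the well-definedness and the bijection at once.\<close>
  note pull = quotient_bij_betw_pullback[OF equiv_WSQF_rel map WRQF_rel_iff_WSQF_rel[OF assms(3,4)]]
  have cls: "wrqf_to_wsqf_class G (units_of K) =
      (\<lambda>C. \<Union>t\<in>C. WSQF_rel G (units_of K) `` {wrqf_to_wsqf G (units_of K) t})"
    by (simp add: fun_eq_iff wrqf_to_wsqf_class_def)
  show ?thesis
    unfolding cls using pull equiv_WSQF_rel map by auto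
qed

end
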